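(* Let $(M,\varphi)$ be a $7$-manifold with coclosed $G_2$-structure. If the de Rham cohomology group $H^3(M)$ is $\{0\}$, then every co$G_2$-vector field on $M$ is a coRochesterian vector field.
   Context: On $\mathbb{R}^7$ let $\varphi_0=dx^{123}+dx^{145}+dx^{167}+dx^{246}-dx^{257}-dx^{347}-dx^{356}$, where $dx^{ijk}=dx^i\wedge dx^j\wedge dx^k$. A $G_2$-structure on a smooth $7$-manifold $M$ is a smooth $3$-form $\varphi$ such that for each $p\in M$ there is a linear isomorphism $T_pM\cong\mathbb{R}^7$ carrying $\varphi_p$ to $\varphi_0$. It determines a Riemannian metric $\langle\cdot,\cdot\rangle_\varphi$ and an orientation by $(X\lrcorner\varphi)\wedge(Y\lrcorner\varphi)\wedge\varphi=6\langle X,Y\rangle_\varphi\, d\mathrm{vol}_\varphi$; $\star$ is the associated Hodge star. The structure is coclosed if $d^*\varphi=0$, equivalently $d(\star\varphi)=0$. $\mathcal{X}(M)$ is the space of smooth vector fields and $\Omega^3_7(M)=\{X\lrcorner\star\varphi: X\in\mathcal{X}(M)\}$, where $X\lrcorner\omega=\omega(X,\cdot,\dots)$. The map $X\mapsto X\lrcorner\star\varphi$ is injective. Let $(M,\varphi)$ have a coclosed $G_2$-structure. A coRochesterian $2$-form is a $2$-form $\sigma$ with $d\sigma\in\Omega^3_7(M)$; its coRochesterian vector field is the unique vector field $X_\sigma$ with $X_\sigma\lrcorner\star\varphi=d\sigma$. A vector field is coRochesterian if it equals $X_\sigma$ for some coRochesterian $2$-form $\sigma$. A co$G_2$-vector field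 is a vector field $X$ with $\mathcal{L}_X(\star\varphi)=0$. *)

theory Defs
  imports
    "HOL-Analysis.Analysis"
    "HOL-Combinatorics.Permutations"
    "HOL-Library.Function_Algebras"
begin

section \<open>Functions into a vector space\<close>

instantiation "fun" :: (type, real_vector) real_vector
begin

definition scaleR_fun :: "real \<Rightarrow> ('a \<Rightarrow> 'b) \<Rightarrow> 'a \<Rightarrow> 'b" where
  "scaleR_fun r f = (\<lambda>x. r *\<^sub>R f x)"

instance
  by standard (auto simp: scaleR_fun_def fun_eq_iff scaleR_add_right scaleR_add_left)

end


section \<open>Alternating forms on a subspace of a real vector space\<close>

text \<open>A k-linear form takes the list of its k arguments. Outside lists of k vectors of
  \<^term>\<open>V\<close> it is required to vanish, so that equality of forms on \<^term>\<open>V\<close> is plain equality.\<close>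

definition alt_forms :: "nat \<Rightarrow> 'v::real_vector set \<Rightarrow> ('v list \<Rightarrow> real) set" where
  "alt_forms k V = {\<alpha>.
     (\<forall>vs. \<not> (length vs = k \<and> set vs \<subseteq> V) \<longrightarrow> \<alpha> vs = 0) \<and>
     (\<forall>vs i u w a b. length vs = k \<and> set vs \<subseteq> V \<and> i < k \<and> u \<in> V \<and> w \<in> V \<longrightarrow>
        \<alpha> (vs[i := a *\<^sub>R u + b *\<^sub>R w]) = a * \<alpha> (vs[i := u]) + b * \<alpha> (vs[i := w])) \<and>
     (\<forall>vs i j. length vs = k \<and> set vs \<subseteq> V \<and> i < j \<and> j < k \<and> vs ! i = vs ! j \<longrightarrow> \<alpha> vs = 0)}"

text \<open>The normalisation is the one with \<open>(dx\<^sup>1 \<and> dx\<^sup>2) (e\<^sub>1, e\<^sub>2) = 1\<close>.\<close>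

definition wedge :: "nat \<Rightarrow> nat \<Rightarrow> ('v list \<Rightarrow> real) \<Rightarrow> ('v list \<Rightarrow> real) \<Rightarrow> 'v list \<Rightarrow> real" where
  "wedge k l \<alpha> \<beta> vs =
     (if length vs = k + l
      then (\<Sum>\<sigma> | \<sigma> permutes {..<k + l}. of_int (sign \<sigma>) *
              \<alpha> (map (\<lambda>i. vs ! \<sigma> i) [0..<k]) * \<beta> (map (\<lambda>i. vs ! \<sigma> i) [k..<k + l]))
           / (fact k * fact l)
      else 0)"

definition contract :: "'v \<Rightarrow> ('v list \<Rightarrow> real) \<Rightarrow> 'v list \<Rightarrow> real" where
  "contract v \<alpha> = (\<lambda>vs. \<alpha> (v # vs))"

definition inner_product_on :: "'v::real_vector set \<Rightarrow> ('v \<Rightarrow> 'v \<Rightarrow> real) \<Rightarrow> bool" where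
  "inner_product_on V g \<longleftrightarrow>
     (\<forall>u v. \<not> (u \<in> V \<and> v \<in> V) \<longrightarrow> g u v = 0) \<and>
     (\<forall>u\<in>V. \<forall>v\<in>V. g u v = g v u) \<and>
     (\<forall>u\<in>V. \<forall>v\<in>V. \<forall>w\<in>V. \<forall>a b. g (a *\<^sub>R u + b *\<^sub>R v) w = a * g u w + b * g v w) \<and>
     (\<forall>u\<in>V. u \<noteq> 0 \<longrightarrow> 0 < g u u)"

definition orthonormal_basis :: "'v::real_vector set \<Rightarrow> ('v \<Rightarrow> 'v \<Rightarrow> real) \<Rightarrow> 'v list \<Rightarrow> bool" where
  "orthonormal_basis V g es \<longleftrightarrow> span (set es) = V \<and>
     (\<forall>i<length es. \<forall>j<length es. g (es ! i) (es ! j) = (if i = j then 1 else 0))"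

text \<open>The volume forms of the inner product \<^term>\<open>g\<close> for the two orientations of \<^term>\<open>V\<close>;
  choosing one of them amounts to choosing an orientation.\<close>

definition volume_form :: "'v::real_vector set \<Rightarrow> ('v \<Rightarrow> 'v \<Rightarrow> real) \<Rightarrow> ('v list \<Rightarrow> real) \<Rightarrow> bool" where
  "volume_form V g vol \<longleftrightarrow> vol \<in> alt_forms (dim V) V \<and>
     (\<forall>es. orthonormal_basis V g es \<longrightarrow> \<bar>vol es\<bar> = 1)"

text \<open>The inner product for which the \<open>e\<^sup>I\<close>, \<open>I\<close> a k-element index set, are orthonormal;
  \<^term>\<open>nths es I\<close> lists the \<open>e\<^sub>i\<close>, \<open>i \<in> I\<close>, in increasing order.\<close>

definition form_inner ::
    "nat \<Rightarrow> 'v::real_vector set \<Rightarrow> ('v \<Rightarrow> 'v \<Rightarrow> real) \<Rightarrow> ('v list \<Rightarrow> real) \<Rightarrow> ('v list \<Rightarrow> real) \<Rightarrow> real" where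
  "form_inner k V g \<alpha> \<beta> = (let es = (SOME es. orthonormal_basis V g es) in
     \<Sum>I | I \<subseteq> {..<length es} \<and> card I = k. \<alpha> (nths es I) * \<beta> (nths es I))"

definition hodge_star ::
    "nat \<Rightarrow> 'v::real_vector set \<Rightarrow> ('v \<Rightarrow> 'v \<Rightarrow> real) \<Rightarrow> ('v list \<Rightarrow> real) \<Rightarrow> ('v list \<Rightarrow> real) \<Rightarrow> 'v list \<Rightarrow> real"
  where
  "hodge_star k V g vol \<beta> = (THE \<eta>. \<eta> \<in> alt_forms (dim V - k) V \<and>
     (\<forall>\<alpha>\<in>alt_forms k V. wedge k (dim V - k) \<alpha> \<eta> = (\<lambda>vs. form_inner k V g \<alpha> \<beta> * vol vs)))"


section \<open>Smooth manifolds\<close>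

text \<open>For open \<^term>\<open>S\<close> in a Euclidean space this is the usual class \<open>C\<^sup>n\<close>.\<close>

primrec Ck_on :: "nat \<Rightarrow> 'b::euclidean_space set \<Rightarrow> ('b \<Rightarrow> 'c::real_normed_vector) \<Rightarrow> bool" where
  "Ck_on 0 S f \<longleftrightarrow> continuous_on S f"
| "Ck_on (Suc n) S f \<longleftrightarrow> (\<forall>x\<in>S. f differentiable at x) \<and>
     (\<forall>v. Ck_on n S (\<lambda>x. frechet_derivative f (at x) v))"

definition smooth_on :: "'b::euclidean_space set \<Rightarrow> ('b \<Rightarrow> 'c::real_normed_vector) \<Rightarrow> bool" where
  "smooth_on S f \<longleftrightarrow> (\<forall>n. Ck_on n S f)"

text \<open>A chart is its domain together with the coordinate map. A tangent vector is represented by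
  its components in all charts of the atlas around its base point (and by 0 in the other charts).\<close>

type_synonym ('a, 'b) chart = "'a set \<times> ('a \<Rightarrow> 'b)"
type_synonym ('a, 'b) tvec = "('a, 'b) chart \<Rightarrow> 'b"
type_synonym ('a, 'b) vfield = "'a \<Rightarrow> ('a, 'b) tvec"
type_synonym ('a, 'b) form = "'a \<Rightarrow> ('a, 'b) tvec list \<Rightarrow> real"

abbreviation cdom :: "('a, 'b) chart \<Rightarrow> 'a set" where "cdom \<equiv> fst"
abbreviation cmap :: "('a, 'b) chart \<Rightarrow> 'a \<Rightarrow> 'b" where "cmap \<equiv> snd"
abbreviation cran :: "('a, 'b) chart \<Rightarrow> 'b set" where "cran c \<equiv> cmap c ` cdom c"

definition cinv :: "('a, 'b) chart \<Rightarrow> 'b \<Rightarrow> 'a" where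
  "cinv c = inv_into (cdom c) (cmap c)"

text \<open>The atlas need not be maximal. The manifold is the whole type \<^typ>\<open>'a\<close>, on which
  the Hausdorff and second countability conditions are imposed as type classes.\<close>

definition smooth_atlas :: "('a::{t2_space, second_countable_topology}, 'b::euclidean_space) chart set \<Rightarrow> bool" where
  "smooth_atlas A \<longleftrightarrow>
     (\<Union>c\<in>A. cdom c) = UNIV \<and>
     (\<forall>c\<in>A. open (cdom c) \<and> open (cran c) \<and> homeomorphism (cdom c) (cran c) (cmap c) (cinv c)) \<and>
     (\<forall>c\<in>A. \<forall>c'\<in>A. smooth_on (cmap c ` (cdom c \<inter> cdom c')) (cmap c' \<circ> cinv c))"

definition tangent_space :: "('a, 'b::euclidean_space) chart set \<Rightarrow> 'a \<Rightarrow> ('a, 'b) tvec set" where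
  "tangent_space A p = {v.
     (\<forall>c. \<not> (c \<in> A \<and> p \<in> cdom c) \<longrightarrow> v c = 0) \<and>
     (\<forall>c\<in>A. \<forall>c'\<in>A. p \<in> cdom c \<and> p \<in> cdom c' \<longrightarrow>
        v c' = frechet_derivative (cmap c' \<circ> cinv c) (at (cmap c p)) (v c))}"

text \<open>The tangent vector at \<^term>\<open>p\<close> with components \<^term>\<open>w\<close> in the chart \<^term>\<open>c\<close>. For fixed
  \<^term>\<open>c\<close> and \<^term>\<open>w\<close> it is, as a function of \<^term>\<open>p\<close>, a coordinate vector field on the
  domain of \<^term>\<open>c\<close>.\<close>

definition coord_vec :: "('a, 'b::euclidean_space) chart set \<Rightarrow> ('a, 'b) chart \<Rightarrow> 'b \<Rightarrow> ('a, 'b) vfield" where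
  "coord_vec A c w p = (\<lambda>c'. if c' \<in> A \<and> p \<in> cdom c'
     then frechet_derivative (cmap c' \<circ> cinv c) (at (cmap c p)) w else 0)"

definition vector_fields :: "('a, 'b::euclidean_space) chart set \<Rightarrow> ('a, 'b) vfield set" where
  "vector_fields A = {X. (\<forall>p. X p \<in> tangent_space A p) \<and>
     (\<forall>c\<in>A. smooth_on (cran c) (\<lambda>x. X (cinv c x) c))}"

definition local_rep ::
    "('a, 'b::euclidean_space) chart set \<Rightarrow> ('a, 'b) form \<Rightarrow> ('a, 'b) chart \<Rightarrow> 'b \<Rightarrow> 'b list \<Rightarrow> real" where
  "local_rep A \<omega> c x ws = \<omega> (cinv c x) (map (\<lambda>w. coord_vec A c w (cinv c x)) ws)"

definition forms :: "('a, 'b::euclidean_space) chart set \<Rightarrow> nat \<Rightarrow> ('a, 'b) form set" where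
  "forms A k = {\<omega>. (\<forall>p. \<omega> p \<in> alt_forms k (tangent_space A p)) \<and>
     (\<forall>c\<in>A. \<forall>ws. length ws = k \<longrightarrow> smooth_on (cran c) (\<lambda>x. local_rep A \<omega> c x ws))}"

definition contract_field :: "('a, 'b) vfield \<Rightarrow> ('a, 'b) form \<Rightarrow> ('a, 'b) form" where
  "contract_field X \<omega> = (\<lambda>p. contract (X p) (\<omega> p))"

text \<open>The operators below are given by local formulas, evaluated in one chart around each point.
  On smooth fields and forms their values do not depend on that chart.\<close>

definition chart_at :: "('a, 'b) chart set \<Rightarrow> 'a \<Rightarrow> ('a, 'b) chart" where
  "chart_at A p = (SOME c. c \<in> A \<and> p \<in> cdom c)"

definition ext_deriv :: "('a, 'b::euclidean_space) chart set \<Rightarrow> ('a, 'b) form \<Rightarrow> ('a, 'b) form" where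
  "ext_deriv A \<omega> p vs = (if set vs \<subseteq> tangent_space A p
     then let c = chart_at A p; ws = map (\<lambda>v. v c) vs in
       \<Sum>i<length vs. (-1) ^ i *
         frechet_derivative (\<lambda>x. local_rep A \<omega> c x (take i ws @ drop (Suc i) ws)) (at (cmap c p)) (ws ! i)
     else 0)"

definition dir_deriv ::
    "('a, 'b::euclidean_space) chart set \<Rightarrow> ('a, 'b) vfield \<Rightarrow> ('a \<Rightarrow> real) \<Rightarrow> 'a \<Rightarrow> real" where
  "dir_deriv A X f p = (let c = chart_at A p in
     frechet_derivative (f \<circ> cinv c) (at (cmap c p)) (X p c))"

definition lie_bracket ::
    "('a, 'b::euclidean_space) chart set \<Rightarrow> ('a, 'b) vfield \<Rightarrow> ('a, 'b) vfield \<Rightarrow> ('a, 'b) vfield" where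
  "lie_bracket A X Y p = (let c = chart_at A p in
     coord_vec A c
       (frechet_derivative (\<lambda>x. Y (cinv c x) c) (at (cmap c p)) (X p c) -
        frechet_derivative (\<lambda>x. X (cinv c x) c) (at (cmap c p)) (Y p c)) p)"

text \<open>The Lie derivative of a form as tensor derivation,
  \<open>(L\<^sub>X \<omega>) (Y\<^sub>1, \<dots>, Y\<^sub>k) = X (\<omega> (Y\<^sub>1, \<dots>, Y\<^sub>k)) - \<Sum>\<^sub>i \<omega> (Y\<^sub>1, \<dots>, [X, Y\<^sub>i], \<dots>, Y\<^sub>k)\<close>.
  Its right-hand side is tensorial in the \<open>Y\<^sub>i\<close>; the arguments at \<^term>\<open>p\<close> are extended to
  a neighbourhood of \<^term>\<open>p\<close> as coordinate vector fields.\<close>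

definition lie_deriv ::
    "('a, 'b::euclidean_space) chart set \<Rightarrow> ('a, 'b) vfield \<Rightarrow> ('a, 'b) form \<Rightarrow> ('a, 'b) form" where
  "lie_deriv A X \<omega> p vs = (if set vs \<subseteq> tangent_space A p
     then let c = chart_at A p; Ys = map (\<lambda>v. coord_vec A c (v c)) vs in
       dir_deriv A X (\<lambda>q. \<omega> q (map (\<lambda>Y. Y q) Ys)) p -
       (\<Sum>i<length vs. \<omega> p (vs[i := lie_bracket A X (Ys ! i) p]))
     else 0)"


section \<open>De Rham cohomology\<close>

definition closed_forms :: "('a, 'b::euclidean_space) chart set \<Rightarrow> nat \<Rightarrow> ('a, 'b) form set" where
  "closed_forms A k = {\<omega> \<in> forms A k. ext_deriv A \<omega> = 0}"

definition exact_forms :: "('a, 'b::euclidean_space) chart set \<Rightarrow> nat \<Rightarrow> ('a, 'b) form set" where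
  "exact_forms A k = (if k = 0 then {0} else ext_deriv A ` forms A (k - 1))"

definition cohomologous :: "('a, 'b::euclidean_space) chart set \<Rightarrow> nat \<Rightarrow> (('a, 'b) form \<times> ('a, 'b) form) set" where
  "cohomologous A k = {(\<alpha>, \<beta>). \<alpha> \<in> closed_forms A k \<and> \<beta> \<in> closed_forms A k \<and> \<alpha> - \<beta> \<in> exact_forms A k}"

definition de_rham :: "('a, 'b::euclidean_space) chart set \<Rightarrow> nat \<Rightarrow> ('a, 'b) form set set" where
  "de_rham A k = closed_forms A k // cohomologous A k"

definition de_rham_class :: "('a, 'b::euclidean_space) chart set \<Rightarrow> nat \<Rightarrow> ('a, 'b) form \<Rightarrow> ('a, 'b) form set" where
  "de_rham_class A k \<omega> = cohomologous A k `` {\<omega>}"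


section \<open>G2-structures\<close>

text \<open>The index type \<^typ>\<open>7\<close> consists of the residues modulo 7, so its elements are
  \<open>1, \<dots>, 7\<close> with \<open>7 = 0\<close>.\<close>

definition dx :: "7 \<Rightarrow> (real ^ 7) list \<Rightarrow> real" where
  "dx i vs = (if length vs = 1 then hd vs $ i else 0)"

definition dx3 :: "7 \<Rightarrow> 7 \<Rightarrow> 7 \<Rightarrow> (real ^ 7) list \<Rightarrow> real" where
  "dx3 i j k = wedge 1 2 (dx i) (wedge 1 1 (dx j) (dx k))"

definition phi0 :: "(real ^ 7) list \<Rightarrow> real" where
  "phi0 = dx3 1 2 3 + dx3 1 4 5 + dx3 1 6 7 + dx3 2 4 6 - dx3 2 5 7 - dx3 3 4 7 - dx3 3 5 6"

definition G2_structure :: "('a, real ^ 7) chart set \<Rightarrow> ('a, real ^ 7) form \<Rightarrow> bool" where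
  "G2_structure A \<phi> \<longleftrightarrow> \<phi> \<in> forms A 3 \<and>
     (\<forall>p. \<exists>L. bij_betw L (tangent_space A p) UNIV \<and>
        (\<forall>u\<in>tangent_space A p. \<forall>v\<in>tangent_space A p. \<forall>a b.
           L (a *\<^sub>R u + b *\<^sub>R v) = a *\<^sub>R L u + b *\<^sub>R L v) \<and>
        (\<forall>u\<in>tangent_space A p. \<forall>v\<in>tangent_space A p. \<forall>w\<in>tangent_space A p.
           \<phi> p [u, v, w] = phi0 [L u, L v, L w]))"

definition G2_metric_vol ::
    "('v::real_vector) set \<Rightarrow> ('v list \<Rightarrow> real) \<Rightarrow> ('v \<Rightarrow> 'v \<Rightarrow> real) \<times> ('v list \<Rightarrow> real)" where
  "G2_metric_vol V \<alpha> = (THE (g, vol). inner_product_on V g \<and> volume_form V g vol \<and>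
     (\<forall>u\<in>V. \<forall>v\<in>V. wedge 4 3 (wedge 2 2 (contract u \<alpha>) (contract v \<alpha>)) \<alpha> = (\<lambda>vs. 6 * g u v * vol vs)))"

text \<open>The Hodge dual of \<^term>\<open>\<phi>\<close> for the metric and orientation determined by \<^term>\<open>\<phi>\<close>.\<close>

definition G2_star :: "('a, real ^ 7) chart set \<Rightarrow> ('a, real ^ 7) form \<Rightarrow> ('a, real ^ 7) form" where
  "G2_star A \<phi> p = (case G2_metric_vol (tangent_space A p) (\<phi> p) of
     (g, vol) \<Rightarrow> hodge_star 3 (tangent_space A p) g vol (\<phi> p))"

definition coclosed_G2_structure :: "('a, real ^ 7) chart set \<Rightarrow> ('a, real ^ 7) form \<Rightarrow> bool" where
  "coclosed_G2_structure A \<phi> \<longleftrightarrow> G2_structure A \<phi> \<and> G2_star A \<phi> \<in> closed_forms A 4"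

definition forms37 :: "('a, real ^ 7) chart set \<Rightarrow> ('a, real ^ 7) form \<Rightarrow> ('a, real ^ 7) form set" where
  "forms37 A \<phi> = {contract_field X (G2_star A \<phi>) | X. X \<in> vector_fields A}"

definition coRochesterian_form :: "('a, real ^ 7) chart set \<Rightarrow> ('a, real ^ 7) form \<Rightarrow> ('a, real ^ 7) form \<Rightarrow> bool" where
  "coRochesterian_form A \<phi> \<sigma> \<longleftrightarrow> \<sigma> \<in> forms A 2 \<and> ext_deriv A \<sigma> \<in> forms37 A \<phi>"

text \<open>\<^term>\<open>X\<close> is the coRochesterian vector field of \<^term>\<open>\<sigma>\<close>. It is unique, because contraction
  with the Hodge dual of \<^term>\<open>\<phi>\<close> is injective on vector fields.\<close>

definition coRochesterian_field_of ::
    "('a, real ^ 7) chart set \<Rightarrow> ('a, real ^ 7) form \<Rightarrow> ('a, real ^ 7) form \<Rightarrow> ('a, real ^ 7) vfield \<Rightarrow> bool" where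
  "coRochesterian_field_of A \<phi> \<sigma> X \<longleftrightarrow>
     X \<in> vector_fields A \<and> contract_field X (G2_star A \<phi>) = ext_deriv A \<sigma>"

definition coRochesterian_vector_field ::
    "('a, real ^ 7) chart set \<Rightarrow> ('a, real ^ 7) form \<Rightarrow> ('a, real ^ 7) vfield \<Rightarrow> bool" where
  "coRochesterian_vector_field A \<phi> X \<longleftrightarrow>
     (\<exists>\<sigma>. coRochesterian_form A \<phi> \<sigma> \<and> coRochesterian_field_of A \<phi> \<sigma> X)"

definition coG2_vector_field ::
    "('a, real ^ 7) chart set \<Rightarrow> ('a, real ^ 7) form \<Rightarrow> ('a, real ^ 7) vfield \<Rightarrow> bool" where
  "coG2_vector_field A \<phi> X \<longleftrightarrow> X \<in> vector_fields A \<and> lie_deriv A X (G2_star A \<phi>) = 0"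

end

theory Submission
  imports Defs
begin

text \<open>By Cartan's formula \<open>L\<^sub>X = d i\<^sub>X + i\<^sub>X d\<close> and closedness of the Hodge dual of \<open>\<phi>\<close>, a
  co\<open>G\<^sub>2\<close>-vector field \<open>X\<close> has a closed contraction with that dual; if \<open>H\<^sup>3\<close> vanishes, the
  contraction is \<open>d\<sigma>\<close> for some 2-form \<open>\<sigma>\<close>. Cartan's formula is checked pointwise in the chart
  used by the operators: the product rule splits \<open>d (i\<^sub>X \<omega>)\<close> into derivatives of \<open>\<omega>\<close>, which combine
  with \<open>i\<^sub>X d\<omega>\<close> to the derivative of \<open>\<omega>\<close> along \<open>X\<close>, and derivatives of \<open>X\<close>, which are the bracket
  terms because \<open>[X, \<partial>\<^sub>w]\<close> is minus the derivative of \<open>X\<close> along \<open>w\<close>.\<close>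


section \<open>Closure properties of C^n and smooth functions on open sets\<close>

section \<open>Functions of class $C^n$\<close>

text \<open>\<open>Ck_on\<close> uses unrestricted derivatives \<open>at x\<close>, which see only a
  neighbourhood of \<open>x\<close>. Since \<open>S\<close> is open, agreement on \<open>S\<close>
  passes to the derivatives, and the induction can apply to them.\<close>

lemma Ck_on_cong:
  assumes "open S" "\<And>x. x \<in> S \<Longrightarrow> f x = g x" "Ck_on n S f"
  shows "Ck_on n S g"
  using assms(2,3)
proof (induction n arbitrary: f g)
  case 0
  then show ?case
    using continuous_on_cong[of S S f g] by simp
next
  case (Suc n)
  have g: "(g has_derivative frechet_derivative f (at x)) (at x)" if "x \<in> S" for x
  proof (rule has_derivative_transform_within_open[OF _ assms(1) that])
    show "(f has_derivative frechet_derivative f (at x)) (at x)"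
      using Suc.prems(2) that by (simp add: frechet_derivative_works)
  qed (rule Suc.prems(1))
  have "Ck_on n S (\<lambda>x. frechet_derivative g (at x) v)" for v
    by (rule Suc.IH[where f = "\<lambda>x. frechet_derivative f (at x) v"])
      (use Suc.prems(2) frechet_derivative_at[OF g] in simp_all)
  with g show ?case
    by (auto simp: differentiable_def)
qed

text \<open>The recursion for \<open>Suc n\<close> mentions only derivatives, so lowering the order
  needs an induction. It bottoms out in differentiability implying continuity.\<close>

lemma Ck_on_SucD: "Ck_on (Suc n) S f \<Longrightarrow> Ck_on n S f"
proof (induction n arbitrary: f)
  case 0
  then show ?case
    by (auto simp: continuous_on_eq_continuous_at intro!: continuous_at_imp_continuous_on
        differentiable_imp_continuous_within)
next
  case (Suc n)
  from Suc.prems have "\<forall>x\<in>S. f differentiable at x"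
    and "\<And>v. Ck_on (Suc n) S (\<lambda>x. frechet_derivative f (at x) v)"
    by simp_all
  with Suc.IH show ?case by (auto simp del: Ck_on.simps simp: Ck_on.simps(2)[of n S f])
qed

lemma Ck_on_const: "Ck_on n S (\<lambda>x. c)"
  by (induction n arbitrary: c) auto

text \<open>A directional derivative of the composite is \<open>h\<close> applied to one of
  \<open>f\<close>, which is again of the shape in the claim. Hence the induction varies
  \<open>f\<close>; the closure lemmas for sums and products follow the same pattern.\<close>

lemma Ck_on_bounded_linear:
  assumes "open S" "bounded_linear h" "Ck_on n S f"
  shows "Ck_on n S (\<lambda>x. h (f x))"
  using assms(3)
proof (induction n arbitrary: f)
  case 0
  then show ?case
    by (simp add: bounded_linear.continuous_on[OF assms(2)])
next
  case (Suc n)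
  have d: "((\<lambda>x. h (f x)) has_derivative (\<lambda>v. h (frechet_derivative f (at x) v))) (at x)"
    if "x \<in> S" for x
    using Suc.prems that by (intro bounded_linear.has_derivative[OF assms(2)])
      (auto simp: frechet_derivative_works)
  have "Ck_on n S (\<lambda>x. frechet_derivative (\<lambda>x. h (f x)) (at x) v)" for v
    by (rule Ck_on_cong[OF assms(1) _ Suc.IH[of "\<lambda>x. frechet_derivative f (at x) v"]])
      (use Suc.prems frechet_derivative_at[OF d] in \<open>simp_all add: fun_eq_iff\<close>)
  with d show ?case
    by (auto simp: differentiable_def)
qed

lemma Ck_on_add:
  assumes "open S" "Ck_on n S f" "Ck_on n S g"
  shows "Ck_on n S (\<lambda>x. f x + g x)"
  using assms(2,3)
proof (induction n arbitrary: f g)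
  case 0
  then show ?case
    by (simp add: continuous_on_add)
next
  case (Suc n)
  have d: "((\<lambda>x. f x + g x) has_derivative
      (\<lambda>v. frechet_derivative f (at x) v + frechet_derivative g (at x) v)) (at x)"
    if "x \<in> S" for x
    using Suc.prems that by (intro has_derivative_add) (auto simp: frechet_derivative_works)
  have "Ck_on n S (\<lambda>x. frechet_derivative (\<lambda>x. f x + g x) (at x) v)" for v
    by (rule Ck_on_cong[OF assms(1) _ Suc.IH[of "\<lambda>x. frechet_derivative f (at x) v"
            "\<lambda>x. frechet_derivative g (at x) v"]])
      (use Suc.prems frechet_derivative_at[OF d] in \<open>simp_all add: fun_eq_iff\<close>)
  with d show ?case
    by (auto simp: differentiable_def)
qed

lemma Ck_on_mult:
  fixes f g :: "'b::euclidean_space \<Rightarrow> real"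
  assumes "open S" "Ck_on n S f" "Ck_on n S g"
  shows "Ck_on n S (\<lambda>x. f x * g x)"
  using assms(2,3)
proof (induction n arbitrary: f g)
  case 0
  then show ?case
    by (simp add: continuous_on_mult)
next
  case (Suc n)
  have d: "((\<lambda>x. f x * g x) has_derivative
      (\<lambda>v. f x * frechet_derivative g (at x) v + frechet_derivative f (at x) v * g x)) (at x)"
    if "x \<in> S" for x
    using Suc.prems that by (intro has_derivative_mult) (auto simp: frechet_derivative_works)
  have "Ck_on n S (\<lambda>x. frechet_derivative (\<lambda>x. f x * g x) (at x) v)" for v
  proof (rule Ck_on_cong[OF assms(1)])
    \<comment> \<open>The product rule mixes derivatives, which are C^n by assumption, with the
      undifferentiated factors, which must first be lowered from order \<open>Suc n\<close> to
      \<open>n\<close>.\<close>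
    show "Ck_on n S (\<lambda>x. f x * frechet_derivative g (at x) v + frechet_derivative f (at x) v * g x)"
      using Suc.prems Suc.prems[THEN Ck_on_SucD] by (intro Ck_on_add[OF assms(1)] Suc.IH) auto
  qed (use frechet_derivative_at[OF d] in \<open>simp_all add: fun_eq_iff\<close>)
  with d show ?case
    by (auto simp: differentiable_def)
qed

lemma smooth_on_cong:
  "open S \<Longrightarrow> (\<And>x. x \<in> S \<Longrightarrow> f x = g x) \<Longrightarrow> smooth_on S f \<Longrightarrow> smooth_on S g"
  unfolding smooth_on_def using Ck_on_cong by blast

lemma smooth_on_const: "smooth_on S (\<lambda>x. c)"
  by (simp add: smooth_on_def Ck_on_const)

lemma smooth_on_inner_left: "open S \<Longrightarrow> smooth_on S f \<Longrightarrow> smooth_on S (\<lambda>x. f x \<bullet> b)"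
  by (simp add: smooth_on_def Ck_on_bounded_linear[OF _ bounded_linear_inner_left])

lemma smooth_on_mult:
  fixes f g :: "'b::euclidean_space \<Rightarrow> real"
  shows "open S \<Longrightarrow> smooth_on S f \<Longrightarrow> smooth_on S g \<Longrightarrow> smooth_on S (\<lambda>x. f x * g x)"
  by (simp add: smooth_on_def Ck_on_mult)

lemma smooth_on_sum:
  assumes "open S" "\<And>i. i \<in> I \<Longrightarrow> smooth_on S (f i)"
  shows "smooth_on S (\<lambda>x. \<Sum>i\<in>I. f i x)"
  using assms(2)
  by (induction I rule: infinite_finite_induct)
    (auto simp: smooth_on_def Ck_on_const intro!: Ck_on_add[OF assms(1)])

lemma smooth_on_imp_has_derivative:
  assumes "smooth_on S f" "x \<in> S"
  shows "(f has_derivative frechet_derivative f (at x)) (at x)"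
proof -
  have "Ck_on (Suc 0) S f"
    using assms(1) unfolding smooth_on_def by blast
  with assms(2) show ?thesis
    by (simp add: frechet_derivative_works)
qed


section \<open>Transpositions, moved arguments and contraction for alternating forms\<close>

section \<open>Alternating forms\<close>

lemma alt_forms_eq_0: "\<alpha> \<in> alt_forms k V \<Longrightarrow> \<not> (length vs = k \<and> set vs \<subseteq> V) \<Longrightarrow> \<alpha> vs = 0"
  by (simp add: alt_forms_def)

lemma alt_forms_linear:
  "\<alpha> \<in> alt_forms k V \<Longrightarrow> length vs = k \<Longrightarrow> set vs \<subseteq> V \<Longrightarrow> i < k \<Longrightarrow> u \<in> V \<Longrightarrow> w \<in> V \<Longrightarrow>
    \<alpha> (vs[i := a *\<^sub>R u + b *\<^sub>R w]) = a * \<alpha> (vs[i := u]) + b * \<alpha> (vs[i := w])"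
  by (simp add: alt_forms_def)

lemma alt_forms_alternating:
  "\<alpha> \<in> alt_forms k V \<Longrightarrow> length vs = k \<Longrightarrow> set vs \<subseteq> V \<Longrightarrow> i < j \<Longrightarrow> j < k \<Longrightarrow> vs ! i = vs ! j \<Longrightarrow>
    \<alpha> vs = 0"
  unfolding alt_forms_def by blast

lemma alt_forms_linear_Cons:
  assumes "\<alpha> \<in> alt_forms (Suc k) UNIV" "length vs = k"
  shows "linear (\<lambda>u. \<alpha> (u # vs))"
  \<comment> \<open>The head 0 is a placeholder that the update at position 0 overwrites. The two
    instances give additivity and homogeneity.\<close>
  using alt_forms_linear[OF assms(1), of "0 # vs" 0 _ _ 1 1]
    alt_forms_linear[OF assms(1), of "0 # vs" 0 _ 0 _ 0] assms(2)
  by (intro linearI) auto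

text \<open>Polarisation: with \<open>x + y\<close> in both adjacent slots the form vanishes, and of
  the four terms of the expansion the two with a repeated argument vanish as well.\<close>

lemma alt_forms_swap:
  fixes x y :: "'v::real_vector"
  assumes \<alpha>: "\<alpha> \<in> alt_forms k UNIV" and k: "length xs + Suc (Suc (length zs)) = k"
  shows "\<alpha> (xs @ x # y # zs) = - \<alpha> (xs @ y # x # zs)"
proof -
  let ?n = "length xs"
  have 1: "\<alpha> (xs @ (u + v) # w # zs) = \<alpha> (xs @ u # w # zs) + \<alpha> (xs @ v # w # zs)" for u v w
    using alt_forms_linear[OF \<alpha>, of "xs @ u # w # zs" ?n u v 1 1] k by simp
  have 2: "\<alpha> (xs @ w # (u + v) # zs) = \<alpha> (xs @ w # u # zs) + \<alpha> (xs @ w # v # zs)" for u v w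
    using alt_forms_linear[OF \<alpha>, of "xs @ w # u # zs" "Suc ?n" u v 1 1] k
    by (simp add: list_update_append)
  have 3: "\<alpha> (xs @ u # u # zs) = 0" for u
    using alt_forms_alternating[OF \<alpha>, of "xs @ u # u # zs" ?n "Suc ?n"] k
    by (simp add: nth_append)
  have "\<alpha> (xs @ (x + y) # (x + y) # zs) = 0"
    by (rule 3)
  then have "\<alpha> (xs @ x # y # zs) + \<alpha> (xs @ y # x # zs) = 0"
    unfolding 1 2 by (simp add: 3)
  then show ?thesis
    by linarith
qed

text \<open>Each entry of \<open>xs\<close> that \<open>u\<close> passes costs one adjacent
  transposition. The resulting sign is the one in the formula for \<open>ext_deriv\<close>.\<close>

lemma alt_forms_move_to_front:
  fixes u :: "'v::real_vector"
  assumes \<alpha>: "\<alpha> \<in> alt_forms k UNIV" and k: "Suc (length xs + length zs) = k"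
  shows "\<alpha> (xs @ u # zs) = (-1) ^ length xs * \<alpha> (u # xs @ zs)"
  using k
proof (induction xs arbitrary: zs rule: rev_induct)
  case Nil
  then show ?case by simp
next
  case (snoc y ys)
  then have "\<alpha> (ys @ y # u # zs) = - \<alpha> (ys @ u # y # zs)"
    by (intro alt_forms_swap[OF \<alpha>]) simp
  also have "\<alpha> (ys @ u # y # zs) = (-1) ^ length ys * \<alpha> (u # ys @ y # zs)"
    using snoc.prems by (intro snoc.IH) simp
  finally show ?case by simp
qed

lemma contract_in_alt_forms:
  assumes "\<alpha> \<in> alt_forms (Suc k) V" "v \<in> V"
  shows "contract v \<alpha> \<in> alt_forms k V"
  unfolding alt_forms_def contract_def
proof (intro CollectI conjI allI impI; (elim conjE)?)
  fix vs assume "\<not> (length vs = k \<and> set vs \<subseteq> V)"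
  then show "\<alpha> (v # vs) = 0"
    using alt_forms_eq_0[OF assms(1)] by simp
next
  fix vs i u w a b
  assume "length vs = k" "set vs \<subseteq> V" "i < k" "u \<in> V" "w \<in> V"
  then show "\<alpha> (v # vs[i := a *\<^sub>R u + b *\<^sub>R w]) = a * \<alpha> (v # vs[i := u]) + b * \<alpha> (v # vs[i := w])"
    using alt_forms_linear[OF assms(1), of "v # vs" "Suc i" u w a b] assms(2) by simp
next
  fix vs i j
  assume "length vs = k" "set vs \<subseteq> V" "i < j" "j < k" "vs ! i = vs ! j"
  then show "\<alpha> (v # vs) = 0"
    using alt_forms_alternating[OF assms(1), of "v # vs" "Suc i" "Suc j"] assms(2) by simp
qed


section \<open>Change of chart, and coordinates on the tangent spaces\<close>

section \<open>Charts and tangent vectors\<close>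

locale atlas =
  fixes A :: "('a::{t2_space, second_countable_topology}, 'b::euclidean_space) chart set"
  assumes smooth_atlas: "smooth_atlas A"
begin

lemma open_cdom: "c \<in> A \<Longrightarrow> open (cdom c)"
  and open_cran: "c \<in> A \<Longrightarrow> open (cran c)"
  and chart_homeomorphism: "c \<in> A \<Longrightarrow> homeomorphism (cdom c) (cran c) (cmap c) (cinv c)"
  using smooth_atlas by (simp_all add: smooth_atlas_def)

lemma cinv_cmap [simp]: "c \<in> A \<Longrightarrow> p \<in> cdom c \<Longrightarrow> cinv c (cmap c p) = p"
  using chart_homeomorphism unfolding homeomorphism_def by blast

lemma chart_at: "chart_at A p \<in> A" "p \<in> cdom (chart_at A p)"
proof -
  have "p \<in> (\<Union>c\<in>A. cdom c)"
    using smooth_atlas by (simp add: smooth_atlas_def)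
  then have "\<exists>c. c \<in> A \<and> p \<in> cdom c" by blast
  from someI_ex[OF this] show "chart_at A p \<in> A" "p \<in> cdom (chart_at A p)"
    unfolding chart_at_def by blast+
qed

lemma open_cmap_image: "c \<in> A \<Longrightarrow> open U \<Longrightarrow> U \<subseteq> cdom c \<Longrightarrow> open (cmap c ` U)"
  using homeomorphism_imp_open_map[OF chart_homeomorphism, of c U] open_cran[of c] open_cdom[of c]
  by (simp add: openin_open_eq)

lemma transition_has_derivative:
  assumes "c \<in> A" "c' \<in> A" "p \<in> cdom c" "p \<in> cdom c'"
  shows "(cmap c' \<circ> cinv c has_derivative frechet_derivative (cmap c' \<circ> cinv c) (at (cmap c p)))
    (at (cmap c p))"
proof (rule smooth_on_imp_has_derivative)
  show "smooth_on (cmap c ` (cdom c \<inter> cdom c')) (cmap c' \<circ> cinv c)"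
    using smooth_atlas assms by (simp add: smooth_atlas_def)
qed (use assms in blast)

text \<open>On the image of the triple overlap, an open set, the transition through
  \<open>c1\<close> equals the direct one, so the chain rule applies. This cocycle identity is what
  makes \<open>coord_vec\<close> satisfy the compatibility condition of
  \<open>tangent_space\<close>.\<close>

lemma transition_chain_rule:
  assumes c: "c \<in> A" "c1 \<in> A" "c2 \<in> A" and p: "p \<in> cdom c" "p \<in> cdom c1" "p \<in> cdom c2"
  shows "frechet_derivative (cmap c2 \<circ> cinv c) (at (cmap c p)) w =
    frechet_derivative (cmap c2 \<circ> cinv c1) (at (cmap c1 p))
      (frechet_derivative (cmap c1 \<circ> cinv c) (at (cmap c p)) w)"
proof -
  let ?U = "cdom c \<inter> cdom c1 \<inter> cdom c2"
  have "((cmap c2 \<circ> cinv c1) \<circ> (cmap c1 \<circ> cinv c) has_derivative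
      frechet_derivative (cmap c2 \<circ> cinv c1) (at (cmap c1 p)) \<circ>
      frechet_derivative (cmap c1 \<circ> cinv c) (at (cmap c p))) (at (cmap c p))"
    using transition_has_derivative[of c c1 p] transition_has_derivative[of c1 c2 p] c p
    by (intro diff_chain_at) auto
  then have "(cmap c2 \<circ> cinv c has_derivative
      frechet_derivative (cmap c2 \<circ> cinv c1) (at (cmap c1 p)) \<circ>
      frechet_derivative (cmap c1 \<circ> cinv c) (at (cmap c p))) (at (cmap c p))"
    by (rule has_derivative_transform_within_open[where s = "cmap c ` ?U"])
      (use c p in \<open>auto intro!: open_cmap_image open_Int open_cdom\<close>)
  from frechet_derivative_at[OF this, symmetric] show ?thesis
    by simp
qed

lemma coord_vec_in_tangent_space:
  assumes "c \<in> A" "p \<in> cdom c"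
  shows "coord_vec A c w p \<in> tangent_space A p"
  unfolding tangent_space_def
proof (intro CollectI conjI allI ballI impI; (elim conjE)?)
  fix c1 c2
  assume "c1 \<in> A" "c2 \<in> A" "p \<in> cdom c1" "p \<in> cdom c2"
  with transition_chain_rule[OF assms(1) this(1,2) assms(2) this(3,4)]
  show "coord_vec A c w p c2 =
      frechet_derivative (cmap c2 \<circ> cinv c1) (at (cmap c1 p)) (coord_vec A c w p c1)"
    unfolding coord_vec_def by (simp only: simp_thms if_True)
qed (auto simp: coord_vec_def)

lemma coord_vec_components [simp]:
  assumes "v \<in> tangent_space A p" "c \<in> A" "p \<in> cdom c"
  shows "coord_vec A c (v c) p = v"
proof
  fix c'
  show "coord_vec A c (v c) p c' = v c'"
  proof (cases "c' \<in> A \<and> p \<in> cdom c'")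
    case True
    then have "v c' = frechet_derivative (cmap c' \<circ> cinv c) (at (cmap c p)) (v c)"
      using assms unfolding tangent_space_def by blast
    with True show ?thesis
      by (simp add: coord_vec_def)
  next
    case False
    then have "v c' = 0"
      using assms(1) unfolding tangent_space_def by blast
    with False show ?thesis
      by (simp only: coord_vec_def if_False)
  qed
qed

text \<open>Near \<open>cmap c p\<close> the transition from a chart to itself is the identity.
  Together with \<open>coord_vec_components\<close>, taking components in \<open>c\<close> and
  \<open>coord_vec\<close> become mutually inverse.\<close>

lemma coord_vec_same_chart [simp]:
  assumes "c \<in> A" "p \<in> cdom c"
  shows "coord_vec A c w p c = w"
proof -
  have "(cmap c \<circ> cinv c has_derivative (\<lambda>v. v)) (at (cmap c p))"
    by (rule has_derivative_transform_within_open[OF has_derivative_ident open_cran])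
      (use assms in auto)
  from frechet_derivative_at[OF this, symmetric] show ?thesis
    using assms by (simp add: coord_vec_def)
qed

lemma coord_vec_linear:
  assumes "c \<in> A" "p \<in> cdom c"
  shows "coord_vec A c (a *\<^sub>R u + b *\<^sub>R w) p = a *\<^sub>R coord_vec A c u p + b *\<^sub>R coord_vec A c w p"
proof
  fix c'
  have "linear (frechet_derivative (cmap c' \<circ> cinv c) (at (cmap c p)))" if "c' \<in> A" "p \<in> cdom c'"
    using has_derivative_linear[OF transition_has_derivative] assms that by blast
  then show "coord_vec A c (a *\<^sub>R u + b *\<^sub>R w) p c' =
      (a *\<^sub>R coord_vec A c u p + b *\<^sub>R coord_vec A c w p) c'"
    by (simp add: coord_vec_def scaleR_fun_def linear_add linear_scale)
qed


section \<open>Coordinate expressions of forms and of their contractions\<close>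

section \<open>Forms in a chart\<close>

lemma form_alt: "\<omega> \<in> forms A k \<Longrightarrow> \<omega> p \<in> alt_forms k (tangent_space A p)"
  by (simp add: forms_def)

lemma smooth_on_local_rep:
  "\<omega> \<in> forms A k \<Longrightarrow> c \<in> A \<Longrightarrow> length ws = k \<Longrightarrow> smooth_on (cran c) (\<lambda>x. local_rep A \<omega> c x ws)"
  by (simp add: forms_def)

text \<open>Recovers a form from its coordinate expression in any chart around \<open>p\<close>, so
  that pointwise identities can be computed in coordinates.\<close>

lemma form_eq_local_rep:
  assumes "c \<in> A" "p \<in> cdom c" "set vs \<subseteq> tangent_space A p"
  shows "\<omega> p vs = local_rep A \<omega> c (cmap c p) (map (\<lambda>v. v c) vs)"
proof -
  have "map (\<lambda>v. coord_vec A c (v c) p) vs = vs"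
    using assms by (intro map_idI) auto
  then show ?thesis
    using assms by (simp add: local_rep_def comp_def)
qed

text \<open>The coordinate expression is the pullback of the form at \<open>p\<close> along the
  linear map \<open>coord_vec\<close>. It lives on all of the model space, where the sign rules for
  alternating forms over \<open>UNIV\<close> apply.\<close>

lemma local_rep_in_alt_forms:
  assumes \<omega>: "\<omega> \<in> forms A k" and c: "c \<in> A" "p \<in> cdom c"
  shows "local_rep A \<omega> c (cmap c p) \<in> alt_forms k UNIV"
proof -
  let ?e = "\<lambda>w. coord_vec A c w p"
  have sub: "set (map ?e ws) \<subseteq> tangent_space A p" for ws
    by (auto intro: coord_vec_in_tangent_space[OF c])
  note \<alpha> = form_alt[OF \<omega>, of p]
  show ?thesis
    unfolding alt_forms_def
  proof (intro CollectI conjI allI impI; (elim conjE)?)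
    fix ws :: "'b list"
    assume "\<not> (length ws = k \<and> set ws \<subseteq> UNIV)"
    then show "local_rep A \<omega> c (cmap c p) ws = 0"
      using c alt_forms_eq_0[OF \<alpha>, of "map ?e ws"] by (simp add: local_rep_def)
  next
    fix ws :: "'b list" and i u w a b
    assume "length ws = k" "i < k"
    then show "local_rep A \<omega> c (cmap c p) (ws[i := a *\<^sub>R u + b *\<^sub>R w]) =
        a * local_rep A \<omega> c (cmap c p) (ws[i := u]) + b * local_rep A \<omega> c (cmap c p) (ws[i := w])"
      using c alt_forms_linear[OF \<alpha> _ sub[of ws], of i "?e u" "?e w" a b] coord_vec_in_tangent_space
      by (simp add: local_rep_def map_update coord_vec_linear)
  next
    fix ws :: "'b list" and i j
    assume "length ws = k" "i < j" "j < k" "ws ! i = ws ! j"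
    then show "local_rep A \<omega> c (cmap c p) ws = 0"
      using c alt_forms_alternating[OF \<alpha> _ sub[of ws], of i j] by (simp add: local_rep_def)
  qed
qed

lemma local_rep_wrong_length:
  assumes "\<omega> \<in> forms A k" "length ws \<noteq> k"
  shows "local_rep A \<omega> c x ws = 0"
  using alt_forms_eq_0[OF form_alt[OF assms(1)]] assms(2) by (simp add: local_rep_def)

lemma local_rep_has_derivative:
  assumes "\<omega> \<in> forms A k" "c \<in> A" "p \<in> cdom c" "length ws = k"
  shows "((\<lambda>x. local_rep A \<omega> c x ws) has_derivative
    frechet_derivative (\<lambda>x. local_rep A \<omega> c x ws) (at (cmap c p))) (at (cmap c p))"
  using smooth_on_imp_has_derivative[OF smooth_on_local_rep] assms by blast

text \<open>Smoothness of a form is stated for constant argument lists only. Expanding the first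
  argument in the basis reduces an argument varying with \<open>x\<close>, such as a vector field,
  to varying scalar coefficients.\<close>

lemma local_rep_Cons_eq_sum:
  assumes "\<omega> \<in> forms A (Suc k)" "c \<in> A" "x \<in> cran c" "length ws = k"
  shows "local_rep A \<omega> c x (u # ws) = (\<Sum>b\<in>Basis. (u \<bullet> b) * local_rep A \<omega> c x (b # ws))"
proof -
  have "local_rep A \<omega> c x \<in> alt_forms (Suc k) UNIV"
    using assms(3) by (auto intro: local_rep_in_alt_forms[OF assms(1,2)])
  from alt_forms_linear_Cons[OF this assms(4)]
  have lin: "linear (\<lambda>u. local_rep A \<omega> c x (u # ws))" .
  have "local_rep A \<omega> c x (u # ws) = local_rep A \<omega> c x ((\<Sum>b\<in>Basis. (u \<bullet> b) *\<^sub>R b) # ws)"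
    by (simp add: euclidean_representation)
  also have "\<dots> = (\<Sum>b\<in>Basis. (u \<bullet> b) * local_rep A \<omega> c x (b # ws))"
    using linear_sum[OF lin, of "\<lambda>b. (u \<bullet> b) *\<^sub>R b" Basis] linear_scale[OF lin] by simp
  finally show ?thesis .
qed

lemma vector_field_tangent: "X \<in> vector_fields A \<Longrightarrow> X p \<in> tangent_space A p"
  by (simp add: vector_fields_def)

lemma local_rep_contract_field:
  assumes "X \<in> vector_fields A" "c \<in> A" "x \<in> cran c"
  shows "local_rep A (contract_field X \<omega>) c x ws = local_rep A \<omega> c x (X (cinv c x) c # ws)"
  using assms vector_field_tangent[OF assms(1)]
  by (auto simp: local_rep_def contract_field_def contract_def)

lemma contract_field_in_forms:
  assumes \<omega>: "\<omega> \<in> forms A (Suc k)" and X: "X \<in> vector_fields A"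
  shows "contract_field X \<omega> \<in> forms A k"
  unfolding forms_def
proof (intro CollectI conjI allI ballI impI)
  fix p show "contract_field X \<omega> p \<in> alt_forms k (tangent_space A p)"
    using contract_in_alt_forms[OF form_alt[OF \<omega>]] vector_field_tangent[OF X]
    by (simp add: contract_field_def)
next
  fix c and ws :: "'b list" assume c: "c \<in> A" and ws: "length ws = k"
  have "smooth_on (cran c) (\<lambda>x. X (cinv c x) c)"
    using X c by (simp add: vector_fields_def)
  then have "smooth_on (cran c)
      (\<lambda>x. \<Sum>b\<in>Basis. (X (cinv c x) c \<bullet> b) * local_rep A \<omega> c x (b # ws))"
    using c ws by (intro smooth_on_sum smooth_on_mult smooth_on_inner_left open_cran
        smooth_on_local_rep[OF \<omega>]) auto
  then show "smooth_on (cran c) (\<lambda>x. local_rep A (contract_field X \<omega>) c x ws)"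
    by (rule smooth_on_cong[OF open_cran[OF c], rotated])
      (simp add: local_rep_contract_field[OF X c] local_rep_Cons_eq_sum[OF \<omega> c _ ws])
qed


section \<open>Coordinate formulas for d of a contraction and for the Lie derivative, and their
  comparison\<close>

section \<open>Cartan's formula\<close>

text \<open>Product rule for the basis expansion of the contraction: the first term freezes the
  field at \<open>p\<close>, the second freezes the form.\<close>

lemma frechet_derivative_contract_field:
  assumes \<omega>: "\<omega> \<in> forms A (Suc k)" and X: "X \<in> vector_fields A"
    and c: "c \<in> A" "p \<in> cdom c" and ws: "length ws = k"
  shows "frechet_derivative (\<lambda>x. local_rep A (contract_field X \<omega>) c x ws) (at (cmap c p)) v =
    frechet_derivative (\<lambda>x. local_rep A \<omega> c x (X p c # ws)) (at (cmap c p)) v +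
    local_rep A \<omega> c (cmap c p) (frechet_derivative (\<lambda>x. X (cinv c x) c) (at (cmap c p)) v # ws)"
proof -
  let ?x = "cmap c p"
  let ?\<xi> = "\<lambda>x. X (cinv c x) c"
  let ?r = "\<lambda>b x. local_rep A \<omega> c x (b # ws)"
  have x: "?x \<in> cran c" using c by simp
  note op = open_cran[OF c(1)]
  note expand = local_rep_Cons_eq_sum[OF \<omega> c(1) _ ws]
  have d\<xi>: "(?\<xi> has_derivative frechet_derivative ?\<xi> (at ?x)) (at ?x)"
    using X c by (intro smooth_on_imp_has_derivative[OF _ x]) (simp add: vector_fields_def)
  have dr: "(?r b has_derivative frechet_derivative (?r b) (at ?x)) (at ?x)" for b
    using local_rep_has_derivative[OF \<omega> c] ws by simp
  have "((\<lambda>x. \<Sum>b\<in>Basis. (?\<xi> x \<bullet> b) * ?r b x) has_derivative (\<lambda>v. \<Sum>b\<in>Basis.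
      (?\<xi> ?x \<bullet> b) * frechet_derivative (?r b) (at ?x) v +
      (frechet_derivative ?\<xi> (at ?x) v \<bullet> b) * ?r b ?x)) (at ?x)"
    by (intro has_derivative_sum has_derivative_mult has_derivative_inner_left d\<xi> dr)
  then have "((\<lambda>x. local_rep A (contract_field X \<omega>) c x ws) has_derivative (\<lambda>v. \<Sum>b\<in>Basis.
      (?\<xi> ?x \<bullet> b) * frechet_derivative (?r b) (at ?x) v +
      (frechet_derivative ?\<xi> (at ?x) v \<bullet> b) * ?r b ?x)) (at ?x)"
    by (rule has_derivative_transform_within_open[OF _ op x])
      (simp add: local_rep_contract_field[OF X c(1)] expand)
  note 1 = frechet_derivative_at[OF this, symmetric]
  \<comment> \<open>The same expansion with the constant argument \<open>X p c\<close> collects the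
    terms that differentiate the form into one derivative.\<close>
  have "((\<lambda>x. \<Sum>b\<in>Basis. (X p c \<bullet> b) * ?r b x) has_derivative (\<lambda>v. \<Sum>b\<in>Basis.
      (X p c \<bullet> b) * frechet_derivative (?r b) (at ?x) v)) (at ?x)"
    by (intro has_derivative_sum has_derivative_mult_right dr)
  then have "(?r (X p c) has_derivative (\<lambda>v. \<Sum>b\<in>Basis.
      (X p c \<bullet> b) * frechet_derivative (?r b) (at ?x) v)) (at ?x)"
    by (rule has_derivative_transform_within_open[OF _ op x]) (simp add: expand)
  note 2 = frechet_derivative_at[OF this, symmetric]
  show ?thesis
    using c by (simp add: 1 2 expand[OF x, of "frechet_derivative ?\<xi> (at ?x) v"] sum.distrib)
qed

text \<open>In its own chart a coordinate field has constant components, so only the derivative of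
  \<open>X\<close> in direction \<open>w\<close> survives in the bracket. The chart must be the one
  in which \<open>lie_bracket\<close> is evaluated.\<close>

lemma lie_bracket_coord_vec:
  assumes "c = chart_at A p"
  shows "lie_bracket A X (coord_vec A c w) p =
    coord_vec A c (- frechet_derivative (\<lambda>x. X (cinv c x) c) (at (cmap c p)) w) p"
proof -
  have c: "c \<in> A" "p \<in> cdom c"
    using chart_at assms by auto
  have "((\<lambda>x. coord_vec A c w (cinv c x) c) has_derivative (\<lambda>_. 0)) (at (cmap c p))"
    by (rule has_derivative_transform_within_open[OF has_derivative_const open_cran])
      (use c in auto)
  from frechet_derivative_at[OF this, symmetric] show ?thesis
    using c by (simp add: lie_bracket_def Let_def flip: assms)
qed

lemma lie_deriv_local:
  assumes \<omega>: "\<omega> \<in> forms A k" and X: "X \<in> vector_fields A"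
    and vs: "set vs \<subseteq> tangent_space A p" "length vs = k" and c: "c = chart_at A p"
    and ws: "ws = map (\<lambda>v. v c) vs"
  shows "lie_deriv A X \<omega> p vs =
    frechet_derivative (\<lambda>x. local_rep A \<omega> c x ws) (at (cmap c p)) (X p c) +
    (\<Sum>i<k. local_rep A \<omega> c (cmap c p)
      (ws[i := frechet_derivative (\<lambda>x. X (cinv c x) c) (at (cmap c p)) (ws ! i)]))"
proof -
  have c': "c \<in> A" "p \<in> cdom c"
    using chart_at c by auto
  let ?D = "frechet_derivative (\<lambda>x. X (cinv c x) c) (at (cmap c p))"
  note \<alpha> = local_rep_in_alt_forms[OF \<omega> c']
  have "\<omega> p (vs[i := lie_bracket A X (coord_vec A c ((vs ! i) c)) p]) =
      - local_rep A \<omega> c (cmap c p) (ws[i := ?D (ws ! i)])" if "i < k" for i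
  proof -
    let ?u = "coord_vec A c (- ?D (ws ! i)) p"
    have "set (vs[i := ?u]) \<subseteq> tangent_space A p"
      using vs(1) coord_vec_in_tangent_space[OF c'] set_update_subset_insert[of vs i ?u] by blast
    then have "\<omega> p (vs[i := ?u]) = local_rep A \<omega> c (cmap c p) (ws[i := - ?D (ws ! i)])"
      using c' by (simp add: form_eq_local_rep[OF c'] map_update ws)
    \<comment> \<open>The minus sign of the bracket leaves the form by linearity; it cancels the one
      in front of the sum in \<open>lie_deriv\<close>.\<close>
    also have "\<dots> = - local_rep A \<omega> c (cmap c p) (ws[i := ?D (ws ! i)])"
      using alt_forms_linear[OF \<alpha>, of ws i "?D (ws ! i)" 0 "-1" 0] that vs(2) ws by simp
    finally show ?thesis
      using that vs(2) by (simp add: lie_bracket_coord_vec[OF c] ws)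
  qed
  \<comment> \<open>The function differentiated along \<open>X\<close> has the coordinate fields as
    arguments, so in the chart it is \<open>local_rep\<close> with the constant arguments
    \<open>ws\<close>.\<close>
  moreover have "(\<lambda>q. \<omega> q (map (\<lambda>Y. Y q) (map (\<lambda>v. coord_vec A c (v c)) vs))) \<circ> cinv c =
      (\<lambda>x. local_rep A \<omega> c x ws)"
    by (simp add: local_rep_def comp_def ws)
  ultimately show ?thesis
    using vs by (simp add: lie_deriv_def dir_deriv_def Let_def sum_negf flip: c)
qed

theorem cartan_formula:
  assumes \<omega>: "\<omega> \<in> forms A (Suc k)" and X: "X \<in> vector_fields A"
  shows "lie_deriv A X \<omega> = ext_deriv A (contract_field X \<omega>) + contract_field X (ext_deriv A \<omega>)"
proof (intro ext)
  fix p and vs :: "('a, 'b) tvec list"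
  define c where "c = chart_at A p"
  define ws where "ws = map (\<lambda>v. v c) vs"
  let ?D = "frechet_derivative (\<lambda>x. X (cinv c x) c) (at (cmap c p))"
  let ?\<alpha> = "local_rep A \<omega> c (cmap c p)"
  let ?d = "\<lambda>us. frechet_derivative (\<lambda>x. local_rep A \<omega> c x us) (at (cmap c p))"
  let ?del = "\<lambda>i. take i ws @ drop (Suc i) ws"
  have c: "c \<in> A" "p \<in> cdom c"
    using chart_at c_def by auto
  note i\<omega> = contract_field_in_forms[OF \<omega> X]
  \<comment> \<open>Equality of forms covers all lists. On non-tangent arguments the operators are 0
    by definition; on lists of wrong length they only differentiate and evaluate forms that vanish
    there.\<close>
  consider "\<not> set vs \<subseteq> tangent_space A p" | "length vs \<noteq> Suc k"
    | "set vs \<subseteq> tangent_space A p" "length vs = Suc k" by blast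
  then show "lie_deriv A X \<omega> p vs =
    (ext_deriv A (contract_field X \<omega>) + contract_field X (ext_deriv A \<omega>)) p vs"
  proof cases
    case 1
    then show ?thesis
      by (auto simp: lie_deriv_def ext_deriv_def contract_field_def contract_def)
  next
    case 2
    then have "\<omega> q (map f vs) = 0" "\<omega> q (vs[i := u]) = 0" for q i u and f :: "_ \<Rightarrow> ('a, 'b) tvec"
      using alt_forms_eq_0[OF form_alt[OF \<omega>]] by auto
    then have "lie_deriv A X \<omega> p vs = 0"
      by (simp add: lie_deriv_def dir_deriv_def Let_def comp_def)
    moreover have "ext_deriv A (contract_field X \<omega>) p vs = 0"
      using 2 by (auto simp: ext_deriv_def Let_def local_rep_wrong_length[OF i\<omega>] intro!: sum.neutral)
    moreover have "ext_deriv A \<omega> p (X p # vs) = 0"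
      using 2 by (auto simp: ext_deriv_def Let_def local_rep_wrong_length[OF \<omega>] intro!: sum.neutral)
    ultimately show ?thesis
      by (simp add: contract_field_def contract_def)
  next
    case 3
    have len: "length ws = Suc k" by (simp add: ws_def 3)
    \<comment> \<open>Matches the two shapes of the terms with derivatives of \<open>X\<close>: the
      bracket puts them in slot \<open>i\<close>, the product rule in front of the list without its
      entry \<open>i\<close>.\<close>
    have front: "?\<alpha> (ws[i := u]) = (-1) ^ i * ?\<alpha> (u # ?del i)" if "i < Suc k" for i u
      using alt_forms_move_to_front[OF local_rep_in_alt_forms[OF \<omega> c], of "take i ws" "drop (Suc i) ws" u]
        that len by (simp add: upd_conv_take_nth_drop)
    have "ext_deriv A (contract_field X \<omega>) p vs = (\<Sum>i<Suc k. (-1) ^ i *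
        frechet_derivative (\<lambda>x. local_rep A (contract_field X \<omega>) c x (?del i)) (at (cmap c p)) (ws ! i))"
      using 3 len by (simp add: ext_deriv_def Let_def del: sum.lessThan_Suc nth_map flip: c_def ws_def)
    also have "\<dots> = (\<Sum>i<Suc k. (-1) ^ i * (?d (X p c # ?del i) (ws ! i) + ?\<alpha> (?D (ws ! i) # ?del i)))"
      using len by (intro sum.cong refl) (simp add: frechet_derivative_contract_field[OF \<omega> X c])
    also have "\<dots> = (\<Sum>i<Suc k. (-1) ^ i * ?d (X p c # ?del i) (ws ! i)) +
        (\<Sum>i<Suc k. ?\<alpha> (ws[i := ?D (ws ! i)]))"
      unfolding sum.distrib[symmetric]
      by (intro sum.cong refl) (simp add: front ring_distribs)
    finally have d: "ext_deriv A (contract_field X \<omega>) p vs = \<dots>" .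
    have "ext_deriv A \<omega> p (X p # vs) = (\<Sum>i<Suc (Suc k). (-1) ^ i *
        ?d (take i (X p c # ws) @ drop (Suc i) (X p c # ws)) ((X p c # ws) ! i))"
      using 3 vector_field_tangent[OF X]
      by (simp add: ext_deriv_def Let_def del: sum.lessThan_Suc nth_map flip: c_def ws_def)
    \<comment> \<open>Index 0 differentiates along \<open>X\<close>. All other indices are shifted
      by one by the extra head, which flips their signs, so this sum cancels the first sum in
      \<open>d\<close>.\<close>
    also have "\<dots> = ?d ws (X p c) - (\<Sum>i<Suc k. (-1) ^ i * ?d (X p c # ?del i) (ws ! i))"
      by (subst sum.lessThan_Suc_shift) (simp add: sum_negf)
    finally have i: "ext_deriv A \<omega> p (X p # vs) = \<dots>" .
    show ?thesis
      using lie_deriv_local[OF \<omega> X 3 c_def ws_def] d i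
      by (simp add: contract_field_def contract_def)
  qed
qed


section \<open>Exactness of closed forms from a trivial de Rham group\<close>

section \<open>Vanishing cohomology\<close>

lemma zero_in_forms: "0 \<in> forms A k"
  by (auto simp: forms_def alt_forms_def local_rep_def smooth_on_const)

lemma ext_deriv_0: "ext_deriv A 0 = 0"
  by (auto simp: ext_deriv_def local_rep_def Let_def fun_eq_iff)

text \<open>As the zero class is the only one, it is also the class of \<open>\<omega>\<close>. It
  contains 0, which says that \<open>\<omega> - 0\<close> is exact.\<close>

lemma closed_imp_exact:
  assumes H: "de_rham A k = {de_rham_class A k 0}" and \<omega>: "\<omega> \<in> closed_forms A k"
  shows "\<omega> \<in> exact_forms A k"
proof -
  have 0: "0 \<in> closed_forms A k" "0 \<in> exact_forms A k"
    using zero_in_forms ext_deriv_0 by (auto simp: closed_forms_def exact_forms_def image_iff)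
  have "de_rham_class A k \<omega> \<in> de_rham A k"
    using \<omega> by (auto simp: de_rham_class_def de_rham_def quotient_def)
  with H have "de_rham_class A k \<omega> = de_rham_class A k 0"
    by simp
  moreover have "0 \<in> de_rham_class A k 0"
    using 0 by (simp add: de_rham_class_def cohomologous_def)
  ultimately have "0 \<in> de_rham_class A k \<omega>"
    by simp
  then show ?thesis
    by (simp add: de_rham_class_def cohomologous_def)
qed

end

theorem corollary2p3:
  fixes A :: "('a::{t2_space, second_countable_topology}, real ^ 7) chart set"
    and \<phi> :: "('a, real ^ 7) form"
  assumes "smooth_atlas A"
    and "coclosed_G2_structure A \<phi>"
    and "de_rham A 3 = {de_rham_class A 3 0}"
  shows "\<forall>X. coG2_vector_field A \<phi> X \<longrightarrow> coRochesterian_vector_field A \<phi> X"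
proof (intro allI impI)
  interpret atlas A
    by standard (fact assms(1))
  fix X
  assume "coG2_vector_field A \<phi> X"
  then have X: "X \<in> vector_fields A" and lie: "lie_deriv A X (G2_star A \<phi>) = 0"
    by (simp_all add: coG2_vector_field_def)
  let ?\<eta> = "contract_field X (G2_star A \<phi>)"
  \<comment> \<open>Degree 4 is written as \<open>Suc 3\<close> to fit Cartan's formula with
    \<open>k = 3\<close>.\<close>
  have star: "G2_star A \<phi> \<in> forms A (Suc 3)" and closed: "ext_deriv A (G2_star A \<phi>) = 0"
    using assms(2) by (simp_all add: coclosed_G2_structure_def closed_forms_def)
  have "contract_field X 0 = 0"
    by (simp add: contract_field_def contract_def fun_eq_iff)
  then have "ext_deriv A ?\<eta> = 0"
    using cartan_formula[OF star X] lie closed by simp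
  then have "?\<eta> \<in> closed_forms A 3"
    using contract_field_in_forms[OF star X] by (simp add: closed_forms_def)
  from closed_imp_exact[OF assms(3) this]
  obtain \<sigma> where "\<sigma> \<in> forms A 2" "ext_deriv A \<sigma> = ?\<eta>"
    by (auto simp: exact_forms_def)
  then show "coRochesterian_vector_field A \<phi> X"
    unfolding coRochesterian_vector_field_def coRochesterian_form_def
      coRochesterian_field_of_def forms37_def
    \<comment> \<open>The equation for \<open>ext_deriv A \<sigma>\<close> serves twice:
      \<open>X\<close> witnesses membership in \<open>forms37\<close>, and \<open>X\<close> is the
      field belonging to \<open>\<sigma>\<close>.\<close>
    using X by (intro exI[of _ \<sigma>]) auto
qed

end
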